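(* Let $G$ be a regular finite simple graph on $n$ vertices with distinct eigenvalues $\theta_0>\theta_1>\cdots>\theta_d$, where $d\ge 2$. Let $\theta_i$ be the largest eigenvalue not greater than $-1$. If $$n\,\frac{\theta_0+\theta_i\theta_{i-1}}{(\theta_0-\theta_i)(\theta_0-\theta_{i-1})}<2,$$ then $G$ has diameter $D=2$.
   Context: The eigenvalues of a graph are those of its adjacency matrix. *)

theory Defs
  imports "Graph_Theory.Graph_Theory" "Jordan_Normal_Form.Spectral_Radius"
begin

text \<open>
  Finite simple graphs are the locale \<open>graph\<close> of the Graph Theory entry: finite symmetric digraphs
  without loops and parallel arcs, an undirected edge being a pair of opposite arcs.
\<close>

definition regular :: "('a, 'b) pre_digraph \<Rightarrow> bool" where
  "regular G \<longleftrightarrow> (\<exists>k. \<forall>v \<in> verts G. out_degree G v = k)"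

text \<open>
  The adjacency matrix depends on an enumeration \<open>vs\<close> of the vertices, intended to be distinct with
  \<open>set vs = verts G\<close>. It is real symmetric when \<open>G\<close> is a graph, so nothing is lost by
  considering only its real eigenvalues.
\<close>

definition adjacency_matrix :: "('a, 'b) pre_digraph \<Rightarrow> 'a list \<Rightarrow> real mat" where
  "adjacency_matrix G vs =
     mat (length vs) (length vs) (\<lambda>(i, j). if vs ! i \<rightarrow>\<^bsub>G\<^esub> vs ! j then 1 else 0)"

text \<open>
  With unit weights, \<open>\<mu>\<close> is the length of a shortest walk, and \<open>\<infinity>\<close> if there is none. Hence
  the diameter of a disconnected graph is \<open>\<infinity>\<close>. The graph without vertices gets \<open>-\<infinity>\<close>.
\<close>

definition graph_diameter :: "('a, 'b) pre_digraph \<Rightarrow> ereal" where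
  "graph_diameter G = (SUP u \<in> verts G. SUP v \<in> verts G. wf_digraph.\<mu> G (\<lambda>_. 1) u v)"

end

theory Submission
  imports Defs
begin

text \<open>
  Let \<open>A\<close> be the adjacency matrix, \<open>k = \<theta>\<^sub>0\<close> the degree and
  \<open>p(x) = (x - \<theta>\<^sub>i) (x - \<theta>\<^bsub>i-1\<^esub>)\<close>. As \<open>p\<close> is nonnegative on the spectrum, \<open>p(A)\<close> is positive
  semidefinite; its diagonal entries are \<open>k + \<theta>\<^sub>i \<theta>\<^bsub>i-1\<^esub>\<close>, and \<open>p(A) 1 = p(k) 1\<close>. If \<open>u\<close> and \<open>v\<close>
  are at distance greater than 2, then \<open>p(A)\<close> vanishes at \<open>(u, v)\<close>, and evaluating the quadratic
  form at the projection of \<open>e\<^sub>u + e\<^sub>v\<close> to the complement of the all-one vector gives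
  \<open>2 (k + \<theta>\<^sub>i \<theta>\<^bsub>i-1\<^esub>) - 4 p(k) / n \<ge> 0\<close>, against the hypothesis. The diameter is at least 2 because
  a complete graph has at most two distinct eigenvalues.

  For \<open>i = 1\<close> one has \<open>p(k) = 0\<close>, so the hypothesis is void in HOL (\<open>x / 0 = 0\<close>). This case does not
  occur: the diagonal \<open>k (1 + \<theta>\<^sub>1)\<close> of \<open>p(A)\<close> is nonpositive, hence \<open>p(A) = 0\<close> and \<open>d \<le> 1\<close>.
\<close>

section \<open>Positive semidefinite matrices and their quadratic forms\<close>

text \<open>Symmetry is not built in; where it matters, \<open>transpose_mat A = A\<close> is
  assumed separately.\<close>

definition psd :: "real mat \<Rightarrow> bool" where
  "psd A \<longleftrightarrow> (\<forall>x \<in> carrier_vec (dim_row A). x \<bullet> (A *\<^sub>v x) \<ge> 0)"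

lemma symmetric_mat_scalar_prod:
  fixes A :: "real mat"
  assumes "A \<in> carrier_mat n n" "transpose_mat A = A" "x \<in> carrier_vec n" "y \<in> carrier_vec n"
  shows "x \<bullet> (A *\<^sub>v y) = y \<bullet> (A *\<^sub>v x)"
proof -
  have "x \<bullet> (A *\<^sub>v y) = (A *\<^sub>v y) \<bullet> x"
    by (rule comm_scalar_prod) (use assms in auto)
  also have "\<dots> = (transpose_mat A *\<^sub>v y) \<bullet> x" using assms by simp
  also have "\<dots> = y \<bullet> (A *\<^sub>v x)"
    using transpose_vec_mult_scalar[OF assms(1,3,4)] by simp
  finally show ?thesis .
qed

lemma quadratic_form_add:
  fixes A :: "real mat"
  assumes A: "A \<in> carrier_mat n n" "transpose_mat A = A" and x: "x \<in> carrier_vec n" and y: "y \<in> carrier_vec n"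
  shows "(x + t \<cdot>\<^sub>v y) \<bullet> (A *\<^sub>v (x + t \<cdot>\<^sub>v y)) =
    x \<bullet> (A *\<^sub>v x) + 2 * t * (x \<bullet> (A *\<^sub>v y)) + t\<^sup>2 * (y \<bullet> (A *\<^sub>v y))"
proof -
  have [simp]: "A *\<^sub>v x \<in> carrier_vec n" "A *\<^sub>v y \<in> carrier_vec n" "t \<cdot>\<^sub>v y \<in> carrier_vec n" "t \<cdot>\<^sub>v (A *\<^sub>v y) \<in> carrier_vec n"
    using A x y by auto
  have *: "A *\<^sub>v (x + t \<cdot>\<^sub>v y) = A *\<^sub>v x + t \<cdot>\<^sub>v (A *\<^sub>v y)"
    using A x y by (simp add: mult_add_distrib_mat_vec[OF A(1)] mult_mat_vec[OF A(1)])
  show ?thesis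
    unfolding * using x y symmetric_mat_scalar_prod[OF A x y]
    by (simp add: add_scalar_prod_distrib[where n=n] scalar_prod_add_distrib[where n=n] algebra_simps power2_eq_square)
qed

text \<open>The form at \<open>x + t y\<close> is a polynomial of degree at most 2 in
  \<open>t\<close> that is never negative. The form need not be definite, so the case of a vanishing
  leading coefficient \<open>c\<close> is treated apart.\<close>

lemma psd_Cauchy_Schwarz:
  assumes A: "A \<in> carrier_mat n n" "transpose_mat A = A" and psd: "psd A"
    and x: "x \<in> carrier_vec n" and y: "y \<in> carrier_vec n"
  shows "(x \<bullet> (A *\<^sub>v y))\<^sup>2 \<le> (x \<bullet> (A *\<^sub>v x)) * (y \<bullet> (A *\<^sub>v y))"
proof -
  define a b c where "a = x \<bullet> (A *\<^sub>v x)" and "b = x \<bullet> (A *\<^sub>v y)" and "c = y \<bullet> (A *\<^sub>v y)"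
  have q: "a + 2 * t * b + t\<^sup>2 * c \<ge> 0" for t
  proof -
    have "x + t \<cdot>\<^sub>v y \<in> carrier_vec n" using x y by simp
    then have "(x + t \<cdot>\<^sub>v y) \<bullet> (A *\<^sub>v (x + t \<cdot>\<^sub>v y)) \<ge> 0" using psd A by (simp add: psd_def)
    then show ?thesis unfolding quadratic_form_add[OF A x y] a_def b_def c_def .
  qed
  have "b\<^sup>2 \<le> a * c"
  proof (cases "c = 0")
    case True
    have "b = 0"
    proof (rule ccontr)
      assume "b \<noteq> 0"
      \<comment> \<open>With \<open>c = 0\<close> the polynomial is linear in \<open>t\<close>; the
        chosen \<open>t\<close> gives it the value -1.\<close>
      then show False using q[of "- (a + 1) / (2 * b)"] True by (simp add: field_simps)
    qed
    then show ?thesis using True by simp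
  next
    case False
    have "c \<ge> 0" using psd A y by (simp add: psd_def c_def)
    with False have "c > 0" by simp
    \<comment> \<open>The polynomial is evaluated at its minimum.\<close>
    then show ?thesis using q[of "- b / c"] by (simp add: field_simps power2_eq_square)
  qed
  then show ?thesis unfolding a_def b_def c_def .
qed

text \<open>A crude bound suffices: \<open>M\<close> dominates every entry in absolute value, and
  each product of two coordinates is at most half the sum of their squares. This gives the factor
  \<open>M * n\<close>; adding 1 keeps \<open>K\<close> strictly positive even when
  \<open>A = 0\<close> or \<open>n = 0\<close>.\<close>

lemma abs_quadratic_form_bound:
  fixes A :: "real mat"
  assumes A: "A \<in> carrier_mat n n"
  obtains K where "K > 0" "\<And>x. x \<in> carrier_vec n \<Longrightarrow> \<bar>x \<bullet> (A *\<^sub>v x)\<bar> \<le> K * (x \<bullet> x)"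
proof -
  define M where "M = (\<Sum>i<n. \<Sum>j<n. \<bar>A $$ (i,j)\<bar>)"
  have M0: "M \<ge> 0" unfolding M_def by (intro sum_nonneg) auto
  have M: "\<bar>A $$ (i,j)\<bar> \<le> M" if "i < n" "j < n" for i j
  proof -
    have "\<bar>A $$ (i,j)\<bar> \<le> (\<Sum>j<n. \<bar>A $$ (i,j)\<bar>)"
      using that by (intro member_le_sum) auto
    also have "\<dots> \<le> M" unfolding M_def
      using that by (intro member_le_sum[where f="\<lambda>i. \<Sum>j<n. \<bar>A $$ (i,j)\<bar>"]) (auto intro!: sum_nonneg)
    finally show ?thesis .
  qed
  have "\<bar>x \<bullet> (A *\<^sub>v x)\<bar> \<le> (M * n + 1) * (x \<bullet> x)" if x: "x \<in> carrier_vec n" for x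
  proof -
    have xx: "x \<bullet> x = (\<Sum>i<n. (x $ i)\<^sup>2)"
      using x by (simp add: scalar_prod_def lessThan_atLeast0 power2_eq_square)
    have "x \<bullet> (A *\<^sub>v x) = (\<Sum>i<n. \<Sum>j<n. x $ i * (A $$ (i,j) * x $ j))"
      using A x by (simp add: scalar_prod_def lessThan_atLeast0 sum_distrib_left)
    also have "\<bar>\<dots>\<bar> \<le> (\<Sum>i<n. \<Sum>j<n. \<bar>x $ i * (A $$ (i,j) * x $ j)\<bar>)"
      by (intro order_trans[OF sum_abs] sum_mono order.refl)
    also have "\<dots> \<le> (\<Sum>i<n. \<Sum>j<n. M / 2 * (x $ i)\<^sup>2 + M / 2 * (x $ j)\<^sup>2)"
    proof (intro sum_mono)
      fix i j assume ij: "i \<in> {..<n}" "j \<in> {..<n}"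
      have "\<bar>x $ i * (A $$ (i,j) * x $ j)\<bar> = \<bar>A $$ (i,j)\<bar> * (\<bar>x $ i\<bar> * \<bar>x $ j\<bar>)"
        by (simp add: abs_mult)
      also have "\<dots> \<le> M * (\<bar>x $ i\<bar> * \<bar>x $ j\<bar>)"
        using M ij by (intro mult_right_mono) auto
      also have "\<dots> \<le> M * (((x $ i)\<^sup>2 + (x $ j)\<^sup>2) / 2)"
        using M0 sum_squares_bound[of "\<bar>x $ i\<bar>" "\<bar>x $ j\<bar>"]
        by (intro mult_left_mono) auto
      finally show "\<bar>x $ i * (A $$ (i,j) * x $ j)\<bar> \<le> M / 2 * (x $ i)\<^sup>2 + M / 2 * (x $ j)\<^sup>2"
        by (simp add: field_simps)
    qed
    also have "\<dots> = M * n * (x \<bullet> x)"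
      unfolding xx
      by (simp only: sum.distrib sum_constant card_lessThan flip: sum_distrib_left)
        (simp add: field_simps)
    also have "\<dots> \<le> (M * n + 1) * (x \<bullet> x)"
      unfolding xx by (intro mult_right_mono) (auto intro: sum_nonneg)
    finally show ?thesis .
  qed
  moreover have "M * n + 1 > 0" using M0 by (simp add: add_nonneg_pos)
  ultimately show ?thesis using that by blast
qed

lemma scalar_prod_self_pos:
  fixes x :: "real vec"
  assumes "x \<in> carrier_vec n" "x \<noteq> 0\<^sub>v n"
  shows "x \<bullet> x > 0"
  using conjugate_square_greater_0_vec[OF assms(1)] assms(2) by simp

lemma smult_mat_mult_vec:
  fixes A :: "real mat"
  assumes "A \<in> carrier_mat n n" "x \<in> carrier_vec n"
  shows "(t \<cdot>\<^sub>m A) *\<^sub>v x = t \<cdot>\<^sub>v (A *\<^sub>v x)"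
  using assms by (intro eq_vecI) auto

lemma quadratic_form_shift:
  fixes A :: "real mat"
  assumes "A \<in> carrier_mat n n" "x \<in> carrier_vec n"
  shows "x \<bullet> ((A + t \<cdot>\<^sub>m 1\<^sub>m n) *\<^sub>v x) = x \<bullet> (A *\<^sub>v x) + t * (x \<bullet> x)"
  using assms
  by (simp add: add_mult_distrib_mat_vec[where nr=n and nc=n] scalar_prod_add_distrib[where n=n] smult_mat_mult_vec[where n=n])

text \<open>Put \<open>w = B x\<close> for the inverse \<open>B\<close> of \<open>A\<close>. Since
  \<open>A w = x\<close>, Cauchy-Schwarz for the form of \<open>A\<close> bounds the square of
  \<open>x \<bullet> x\<close> by the form at \<open>x\<close> times \<open>w \<bullet> x\<close>,
  and the latter is at most \<open>K * (x \<bullet> x)\<close> because the form of \<open>B\<close>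
  is bounded. One factor \<open>x \<bullet> x\<close> cancels.\<close>

lemma psd_invertible_coercive:
  assumes A: "A \<in> carrier_mat n n" "transpose_mat A = A" and psd: "psd A" and "det A \<noteq> 0"
  obtains K :: real where "K > 0" "\<And>x. x \<in> carrier_vec n \<Longrightarrow> x \<bullet> x \<le> K * (x \<bullet> (A *\<^sub>v x))"
proof -
  obtain B where B: "B \<in> carrier_mat n n" "A * B = 1\<^sub>m n"
    using det_non_zero_imp_unit[OF A(1) assms(4), of "()"] by (auto simp: Units_def ring_mat_def)
  obtain K where K: "K > 0" "\<And>x. x \<in> carrier_vec n \<Longrightarrow> \<bar>x \<bullet> (B *\<^sub>v x)\<bar> \<le> K * (x \<bullet> x)"
    using abs_quadratic_form_bound[OF B(1)] by blast
  have "x \<bullet> x \<le> K * (x \<bullet> (A *\<^sub>v x))" if x: "x \<in> carrier_vec n" for x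
  proof (cases "x = 0\<^sub>v n")
    case True
    then show ?thesis using A by simp
  next
    case False
    define w where "w = B *\<^sub>v x"
    have w: "w \<in> carrier_vec n" using B x by (simp add: w_def)
    have Aw: "A *\<^sub>v w = x"
      unfolding w_def using assoc_mult_mat_vec[OF A(1) B(1) x] B(2) x by simp
    have nonneg: "x \<bullet> (A *\<^sub>v x) \<ge> 0" using psd A x by (simp add: psd_def)
    have "(x \<bullet> x)\<^sup>2 \<le> (x \<bullet> (A *\<^sub>v x)) * (w \<bullet> x)"
      using psd_Cauchy_Schwarz[OF A psd x w] by (simp add: Aw)
    also have "\<dots> \<le> (x \<bullet> (A *\<^sub>v x)) * (K * (x \<bullet> x))"
      using K(2)[OF x] comm_scalar_prod[OF w x] nonneg
      by (intro mult_left_mono) (auto simp: w_def)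
    finally have "(x \<bullet> x) * (x \<bullet> x) \<le> (x \<bullet> x) * (K * (x \<bullet> (A *\<^sub>v x)))"
      by (simp add: power2_eq_square mult_ac)
    then show ?thesis using scalar_prod_self_pos[OF x False] by simp
  qed
  with K(1) that show ?thesis by blast
qed

text \<open>The eigenvalue is \<open>- t\<close> for the least \<open>t\<close> such that \<open>A + t I\<close> is positive semidefinite: if this
  matrix were invertible, it would be coercive and \<open>t\<close> could be decreased.\<close>

lemma not_psd_negative_eigenvalue:
  assumes A: "A \<in> carrier_mat n n" "transpose_mat A = A" and "\<not> psd A"
  obtains l where "l < 0" "eigenvalue A l"
proof -
  define S where "S t = A + t \<cdot>\<^sub>m 1\<^sub>m n" for t
  have S: "S t \<in> carrier_mat n n" "transpose_mat (S t) = S t" for t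
    using A by (auto simp: S_def transpose_add[where nr=n and nc=n])
  have psd_S: "psd (S t) \<longleftrightarrow> (\<forall>x \<in> carrier_vec n. x \<bullet> (A *\<^sub>v x) + t * (x \<bullet> x) \<ge> 0)" for t
    using S[of t] A by (auto simp: psd_def S_def quadratic_form_shift)
  define T where "T = {t. psd (S t)}"
  obtain K where K: "\<And>x. x \<in> carrier_vec n \<Longrightarrow> \<bar>x \<bullet> (A *\<^sub>v x)\<bar> \<le> K * (x \<bullet> x)"
    using abs_quadratic_form_bound[OF A(1)] by blast
  have "K \<in> T" using K by (force simp: T_def psd_S)
  obtain z where z: "z \<in> carrier_vec n" "z \<bullet> (A *\<^sub>v z) < 0"
    using assms(3) A by (auto simp: psd_def not_le)
  have "z \<noteq> 0\<^sub>v n" using z A by auto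
  then have zz: "z \<bullet> z > 0" using scalar_prod_self_pos z by blast
  \<comment> \<open>This is minus the Rayleigh quotient at \<open>z\<close>. It is a positive lower
    bound of \<open>T\<close>, which makes the infimum of \<open>T\<close> positive.\<close>
  define b where "b = - (z \<bullet> (A *\<^sub>v z)) / (z \<bullet> z)"
  have b: "b > 0" using zz z by (simp add: b_def divide_neg_pos)
  have lb: "b \<le> t" if "t \<in> T" for t
    using that zz z(1) by (force simp: T_def psd_S b_def field_simps)
  have bdd: "bdd_below T" using lb by (rule bdd_belowI)
  define t where "t = Inf T"
  have "b \<le> t" unfolding t_def using lb \<open>K \<in> T\<close> by (intro cInf_greatest) auto
  then have "t > 0" using b by simp
  have psd: "psd (S t)"
    unfolding psd_S
  proof
    fix x :: "real vec" assume x: "x \<in> carrier_vec n"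
    show "0 \<le> x \<bullet> (A *\<^sub>v x) + t * (x \<bullet> x)"
    proof (cases "x = 0\<^sub>v n")
      case True then show ?thesis using A by simp
    next
      case False
      then have xx: "x \<bullet> x > 0" using scalar_prod_self_pos x by blast
      \<comment> \<open>The infimum is attained: for fixed \<open>x\<close>, minus the Rayleigh
        quotient is a lower bound of \<open>T\<close>, hence at most \<open>Inf T\<close>.\<close>
      have "- (x \<bullet> (A *\<^sub>v x)) / (x \<bullet> x) \<le> t"
        unfolding t_def using \<open>K \<in> T\<close> x xx
        by (intro cInf_greatest) (force simp: T_def psd_S field_simps)+
      then show ?thesis using xx by (simp add: field_simps)
    qed
  qed
  have "det (S t) = 0"
  proof (rule ccontr)
    assume "det (S t) \<noteq> 0"
    from psd_invertible_coercive[OF S psd this]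
    obtain K where K: "K > 0" "\<And>x. x \<in> carrier_vec n \<Longrightarrow> x \<bullet> x \<le> K * (x \<bullet> (S t *\<^sub>v x))"
      by blast
    have "psd (S (t - 1 / K))" unfolding psd_S
    proof
      fix x :: "real vec" assume x: "x \<in> carrier_vec n"
      have "x \<bullet> x \<le> K * (x \<bullet> (A *\<^sub>v x) + t * (x \<bullet> x))"
        using K(2)[OF x] A x by (simp add: S_def quadratic_form_shift)
      then show "0 \<le> x \<bullet> (A *\<^sub>v x) + (t - 1 / K) * (x \<bullet> x)"
        using K(1) by (simp add: field_simps)
    qed
    then have "t \<le> t - 1 / K" unfolding t_def using bdd
      by (intro cInf_lower) (auto simp: T_def)
    then show False using K(1) by (simp add: field_simps)
  qed
  then obtain v where v: "v \<in> carrier_vec n" "v \<noteq> 0\<^sub>v n" "S t *\<^sub>v v = 0\<^sub>v n"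
    using det_0_iff_vec_prod_zero[OF S(1)] by blast
  have "A *\<^sub>v v + t \<cdot>\<^sub>v v = 0\<^sub>v n"
    using v A
    by (simp add: S_def add_mult_distrib_mat_vec[where nr=n and nc=n] smult_mat_mult_vec[where n=n])
  then have "A *\<^sub>v v = (- t) \<cdot>\<^sub>v v"
    using v A
    by (intro eq_vecI) (auto simp: vec_eq_iff eq_neg_iff_add_eq_0)
  then have "eigenvalue A (- t)" using v A by (auto simp: eigenvalue_def eigenvector_def)
  then show ?thesis using that[of "- t"] \<open>t > 0\<close> by simp
qed

section \<open>Quadratic polynomials in a symmetric matrix\<close>

text \<open>The relation says \<open>(A - r) (A - s) y = 0\<close>, where \<open>r\<close> and
  \<open>s\<close> are the roots of \<open>x\<^sup>2 = p * x + q\<close>. Either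
  \<open>(A - s) y\<close> vanishes and \<open>y\<close> is an eigenvector for \<open>s\<close>, or
  \<open>(A - s) y\<close> is an eigenvector for \<open>r\<close>. Symmetry of \<open>A\<close>
  makes the roots real.\<close>

lemma symmetric_mat_eigenvalue_of_quadratic_relation:
  fixes A :: "real mat"
  assumes A: "A \<in> carrier_mat n n" "transpose_mat A = A"
    and y: "y \<in> carrier_vec n" "y \<noteq> 0\<^sub>v n"
    and rel: "A *\<^sub>v (A *\<^sub>v y) = p \<cdot>\<^sub>v (A *\<^sub>v y) + q \<cdot>\<^sub>v y"
  obtains x where "eigenvalue A x" "x\<^sup>2 = p * x + q"
proof -
  have Ay: "A *\<^sub>v y \<in> carrier_vec n" using A y by simp
  have yy: "y \<bullet> y > 0" using scalar_prod_self_pos[OF y] .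
  define D where "D = p\<^sup>2 + 4 * q"
  have "D \<ge> 0"
  proof -
    \<comment> \<open>Completing the square: for \<open>z = (A - p / 2) y\<close>, symmetry and the
      relation give \<open>z \<bullet> z = D / 4 * (y \<bullet> y)\<close>, so the discriminant
      \<open>D\<close> is nonnegative.\<close>
    define z where "z = A *\<^sub>v y + (- (p / 2)) \<cdot>\<^sub>v y"
    have z: "z \<in> carrier_vec n" using Ay y by (simp add: z_def)
    have AyAy: "(A *\<^sub>v y) \<bullet> (A *\<^sub>v y) = p * (y \<bullet> (A *\<^sub>v y)) + q * (y \<bullet> y)"
      using symmetric_mat_scalar_prod[OF A Ay y(1)] Ay y(1)
      by (simp add: rel scalar_prod_add_distrib[where n=n])
    have "z \<bullet> z = (q + (p / 2)\<^sup>2) * (y \<bullet> y)"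
      unfolding z_def using Ay y(1) AyAy comm_scalar_prod[OF Ay y(1)]
      by (simp add: scalar_prod_add_distrib[where n=n] add_scalar_prod_distrib[where n=n]
          algebra_simps power2_eq_square)
    moreover have "z \<bullet> z \<ge> 0" using z by (simp add: scalar_prod_def sum_nonneg)
    ultimately have "q + (p / 2)\<^sup>2 \<ge> 0" using yy by (simp add: zero_le_mult_iff)
    then show ?thesis by (simp add: D_def power2_eq_square)
  qed
  define r s where "r = (p + sqrt D) / 2" and "s = (p - sqrt D) / 2"
  have rs: "r + s = p" "r * s = - q"
    using \<open>D \<ge> 0\<close> by (auto simp: r_def s_def D_def field_simps power2_eq_square)
  have root: "x\<^sup>2 = p * x + q" if "x = r \<or> x = s" for x
    using that rs by (auto simp: power2_eq_square algebra_simps simp flip: rs(1))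
  define z where "z = A *\<^sub>v y + (- s) \<cdot>\<^sub>v y"
  have z: "z \<in> carrier_vec n" using Ay y by (simp add: z_def)
  show ?thesis
  proof (cases "z = 0\<^sub>v n")
    case True
    have "A *\<^sub>v y = s \<cdot>\<^sub>v y"
    proof (rule eq_vecI)
      fix i assume i: "i < dim_vec (s \<cdot>\<^sub>v y)"
      then have "z $ i = 0" using True y by simp
      then show "(A *\<^sub>v y) $ i = (s \<cdot>\<^sub>v y) $ i" using i y A by (simp add: z_def)
    qed (use A y in auto)
    then have "eigenvalue A s" using A y by (auto simp: eigenvalue_def eigenvector_def)
    then show ?thesis using that root by blast
  next
    case False
    have "A *\<^sub>v z = A *\<^sub>v (A *\<^sub>v y) + (- s) \<cdot>\<^sub>v (A *\<^sub>v y)"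
      unfolding z_def using Ay y A
      by (simp add: mult_add_distrib_mat_vec[OF A(1)] mult_mat_vec[OF A(1)])
    also have "\<dots> = r \<cdot>\<^sub>v z"
    proof (rule eq_vecI)
      fix i assume i: "i < dim_vec (r \<cdot>\<^sub>v z)"
      have "p = r + s" "q = - (r * s)" using rs by auto
      then show "(A *\<^sub>v (A *\<^sub>v y) + (- s) \<cdot>\<^sub>v (A *\<^sub>v y)) $ i = (r \<cdot>\<^sub>v z) $ i"
        unfolding rel using i z y A by (simp add: z_def algebra_simps)
    qed (use A y z in auto)
    finally have "eigenvalue A r" using A z False by (auto simp: eigenvalue_def eigenvector_def)
    then show ?thesis using that root by blast
  qed
qed

text \<open>This is \<open>(A - a I) (A - b I)\<close> multiplied out, for square
  \<open>A\<close>.\<close>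

definition quadratic_mat :: "real \<Rightarrow> real \<Rightarrow> real mat \<Rightarrow> real mat" where
  "quadratic_mat a b A = A * A + (- (a + b)) \<cdot>\<^sub>m A + (a * b) \<cdot>\<^sub>m 1\<^sub>m (dim_row A)"

lemma quadratic_mat_carrier [simp]:
  "A \<in> carrier_mat n n \<Longrightarrow> quadratic_mat a b A \<in> carrier_mat n n"
  by (simp add: quadratic_mat_def)

lemma transpose_quadratic_mat:
  assumes "A \<in> carrier_mat n n" "transpose_mat A = A"
  shows "transpose_mat (quadratic_mat a b A) = quadratic_mat a b A"
proof -
  have [simp]: "transpose_mat (A * A) = A * A"
    using assms by (simp add: transpose_mult[where nr=n and n=n and nc=n])
  have [simp]: "transpose_mat (t \<cdot>\<^sub>m A) = t \<cdot>\<^sub>m transpose_mat A" for t and A :: "real mat"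
    by (intro eq_matI) auto
  show ?thesis
    using assms by (simp add: quadratic_mat_def transpose_add[where nr=n and nc=n])
qed

lemma quadratic_mat_mult_vec:
  assumes A: "A \<in> carrier_mat n n" and "x \<in> carrier_vec n"
  shows "quadratic_mat a b A *\<^sub>v x = A *\<^sub>v (A *\<^sub>v x) + (- (a + b)) \<cdot>\<^sub>v (A *\<^sub>v x) + (a * b) \<cdot>\<^sub>v x"
  using assms
  by (simp add: quadratic_mat_def add_mult_distrib_mat_vec[where nr=n and nc=n] smult_mat_mult_vec[where n=n]
      assoc_mult_mat_vec[OF A A])

text \<open>An eigenvector of \<open>(A - a)(A - b)\<close> for a negative eigenvalue \<open>l\<close> satisfies a quadratic relation,
  which yields an eigenvalue \<open>x\<close> of \<open>A\<close> with \<open>(x - a) (x - b) = l\<close>.\<close>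

lemma psd_quadratic_mat:
  fixes A :: "real mat"
  assumes A: "A \<in> carrier_mat n n" "transpose_mat A = A"
    and spec: "\<And>x. eigenvalue A x \<Longrightarrow> (x - a) * (x - b) \<ge> 0"
  shows "psd (quadratic_mat a b A)"
proof (rule ccontr)
  assume "\<not> psd (quadratic_mat a b A)"
  then obtain l where l: "l < 0" "eigenvalue (quadratic_mat a b A) l"
    using not_psd_negative_eigenvalue[OF quadratic_mat_carrier[OF A(1)] transpose_quadratic_mat[OF A]] by blast
  obtain y where y: "y \<in> carrier_vec n" "y \<noteq> 0\<^sub>v n" "quadratic_mat a b A *\<^sub>v y = l \<cdot>\<^sub>v y"
    using l(2) quadratic_mat_carrier[OF A(1), of a b] by (auto simp: eigenvalue_def eigenvector_def)
  have "A *\<^sub>v (A *\<^sub>v y) = (a + b) \<cdot>\<^sub>v (A *\<^sub>v y) + (l - a * b) \<cdot>\<^sub>v y"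
  proof (rule eq_vecI)
    fix i assume i: "i < dim_vec ((a + b) \<cdot>\<^sub>v (A *\<^sub>v y) + (l - a * b) \<cdot>\<^sub>v y)"
    have "(quadratic_mat a b A *\<^sub>v y) $ i = (l \<cdot>\<^sub>v y) $ i" using y(3) by simp
    then show "(A *\<^sub>v (A *\<^sub>v y)) $ i = ((a + b) \<cdot>\<^sub>v (A *\<^sub>v y) + (l - a * b) \<cdot>\<^sub>v y) $ i"
      using i A y(1) by (simp add: quadratic_mat_mult_vec[OF A(1) y(1)] algebra_simps)
  qed (use A y in auto)
  from symmetric_mat_eigenvalue_of_quadratic_relation[OF A y(1,2) this]
  obtain x where x: "eigenvalue A x" "x\<^sup>2 = (a + b) * x + (l - a * b)" by blast
  have "(x - a) * (x - b) = l" using x(2) by (simp add: algebra_simps power2_eq_square)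
  with spec[OF x(1)] l(1) show False by simp
qed

lemma quadratic_mat_eigenvector:
  assumes A: "A \<in> carrier_mat n n" and y: "y \<in> carrier_vec n" and ev: "A *\<^sub>v y = x \<cdot>\<^sub>v y"
  shows "quadratic_mat a b A *\<^sub>v y = ((x - a) * (x - b)) \<cdot>\<^sub>v y"
proof -
  have "A *\<^sub>v (x \<cdot>\<^sub>v y) = x \<cdot>\<^sub>v (x \<cdot>\<^sub>v y)" using y ev by (simp add: mult_mat_vec[OF A])
  then show ?thesis
    unfolding quadratic_mat_mult_vec[OF A y] ev using y
    by (intro eq_vecI) (auto simp: algebra_simps)
qed

lemma quadratic_mat_index:
  assumes "A \<in> carrier_mat n n" "i < n" "j < n"
  shows "quadratic_mat a b A $$ (i, j) =
    (\<Sum>l<n. A $$ (i, l) * A $$ (l, j)) - (a + b) * A $$ (i, j) + (if i = j then a * b else 0)"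
  using assms by (simp add: quadratic_mat_def scalar_prod_def lessThan_atLeast0 algebra_simps)

section \<open>Entries of positive semidefinite matrices\<close>

lemma unit_vec_mult_mat_unit_vec:
  fixes B :: "real mat"
  assumes "B \<in> carrier_mat n n" "i < n" "j < n"
  shows "unit_vec n i \<bullet> (B *\<^sub>v unit_vec n j) = B $$ (i, j)"
  using assms by (simp add: scalar_prod_left_unit scalar_prod_right_unit[where n=n])

text \<open>The form at the sum \<open>x\<close> of the two unit vectors is \<open>2 * c\<close>, as
  the mixed entry vanishes. Removing from \<open>x\<close> its component along the all-one
  eigenvector lowers this to \<open>2 * c - 4 * m / n\<close>, which must still be
  nonnegative.\<close>

lemma psd_two_unit_vecs:
  assumes B: "B \<in> carrier_mat n n" "transpose_mat B = B" and psd: "psd B"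
    and one: "B *\<^sub>v vec n (\<lambda>_. 1) = m \<cdot>\<^sub>v vec n (\<lambda>_. 1)"
    and uv: "u < n" "v < n"
    and ent: "B $$ (u, u) = c" "B $$ (v, v) = c" "B $$ (u, v) = 0"
  shows "2 * m \<le> n * c"
proof -
  define e where "e = vec n (\<lambda>_. 1 :: real)"
  have e: "e \<in> carrier_vec n" by (simp add: e_def)
  have n: "n > 0" using uv by simp
  have ue: "unit_vec n i \<bullet> e = 1" if "i < n" for i
    using that by (simp add: e_def)
  \<comment> \<open>The scalar 1 gives the sum the shape required by
    \<open>quadratic_form_add\<close>.\<close>
  define x :: "real vec" where "x = unit_vec n u + 1 \<cdot>\<^sub>v unit_vec n v"
  have x: "x \<in> carrier_vec n" by (simp add: x_def)
  have xx: "x \<bullet> (B *\<^sub>v x) = 2 * c"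
    unfolding x_def using uv ent
    by (subst quadratic_form_add[OF B]) (auto simp: unit_vec_mult_mat_unit_vec[OF B(1)])
  have xe: "x \<bullet> (B *\<^sub>v e) = 2 * m"
    using e ue uv by (simp add: one[folded e_def] x_def add_scalar_prod_distrib[where n=n])
  have ee: "e \<bullet> (B *\<^sub>v e) = m * n"
    using e by (simp add: one[folded e_def]) (simp add: e_def scalar_prod_def)
  \<comment> \<open>The coefficient \<open>2 / n\<close> makes the vector orthogonal to
    \<open>e\<close>, since \<open>x \<bullet> e = 2\<close> and
    \<open>e \<bullet> e = n\<close>.\<close>
  have "0 \<le> (x + (- (2 / n)) \<cdot>\<^sub>v e) \<bullet> (B *\<^sub>v (x + (- (2 / n)) \<cdot>\<^sub>v e))"
    using psd B x e by (simp add: psd_def)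
  also have "\<dots> = 2 * c - 4 * m / n"
    unfolding quadratic_form_add[OF B x e] xx xe ee using n
    by (simp add: power2_eq_square field_simps)
  finally show ?thesis using n by (simp add: field_simps)
qed

text \<open>Semidefiniteness makes the diagonal nonnegative as well, hence zero; Cauchy-Schwarz at
  two unit vectors then bounds the square of every entry by a product of diagonal entries.\<close>

lemma psd_diag_nonpos_imp_zero:
  assumes B: "B \<in> carrier_mat n n" "transpose_mat B = B" and psd: "psd B"
    and diag: "\<And>i. i < n \<Longrightarrow> B $$ (i, i) \<le> 0"
  shows "B = 0\<^sub>m n n"
proof (rule eq_matI)
  fix i j assume "i < dim_row (0\<^sub>m n n :: real mat)" "j < dim_col (0\<^sub>m n n :: real mat)"
  then have ij: "i < n" "j < n" by auto
  have nonneg: "B $$ (l, l) \<ge> 0" if "l < n" for l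
  proof -
    have "unit_vec n l \<bullet> (B *\<^sub>v unit_vec n l) \<ge> 0" using psd B by (simp add: psd_def)
    then show ?thesis using unit_vec_mult_mat_unit_vec[OF B(1) that that] by simp
  qed
  have "(B $$ (i, j))\<^sup>2 \<le> B $$ (i, i) * B $$ (j, j)"
    using psd_Cauchy_Schwarz[OF B psd unit_vec_carrier unit_vec_carrier, of i j] ij
    by (simp add: unit_vec_mult_mat_unit_vec[OF B(1)])
  also have "B $$ (i, i) = 0" using diag nonneg ij by (simp add: order_antisym)
  finally show "B $$ (i, j) = 0\<^sub>m n n $$ (i, j)" using ij by simp
qed (use B in auto)

section \<open>Eigenvalues and row sums\<close>

lemma mult_mat_vec_index_sum:
  assumes "A \<in> carrier_mat n n" "x \<in> carrier_vec n" "i < n"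
  shows "(A *\<^sub>v x) $ i = (\<Sum>j<n. A $$ (i, j) * x $ j)"
  using assms by (simp add: scalar_prod_def lessThan_atLeast0)

lemma eigenvectorE_sum:
  assumes A: "A \<in> carrier_mat n n" and "eigenvalue A (x :: real)"
  obtains y where "\<And>i. i < n \<Longrightarrow> (\<Sum>j<n. A $$ (i, j) * y $ j) = x * y $ i"
    and "\<exists>i<n. y $ i \<noteq> 0"
proof -
  obtain y where y: "y \<in> carrier_vec n" "y \<noteq> 0\<^sub>v n" "A *\<^sub>v y = x \<cdot>\<^sub>v y"
    using assms by (auto simp: eigenvalue_def eigenvector_def)
  have "\<exists>i<n. y $ i \<noteq> 0" using y(1,2) by (force intro: eq_vecI)
  moreover have "(\<Sum>j<n. A $$ (i, j) * y $ j) = x * y $ i" if "i < n" for i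
    using mult_mat_vec_index_sum[OF A y(1) that] y that by simp
  ultimately show ?thesis using that by blast
qed

text \<open>Take a coordinate of an eigenvector of maximal absolute value \<open>N > 0\<close>. The
  eigenvalue equation there gives \<open>x * N \<le> k * N\<close> by the triangle
  inequality.\<close>

lemma eigenvalue_le_row_sum:
  assumes A: "A \<in> carrier_mat n n" and nonneg: "\<And>i j. i < n \<Longrightarrow> j < n \<Longrightarrow> A $$ (i, j) \<ge> 0"
    and row: "\<And>i. i < n \<Longrightarrow> (\<Sum>j<n. A $$ (i, j)) = k"
    and ev: "eigenvalue A (x :: real)"
  shows "x \<le> k"
proof -
  from eigenvectorE_sum[OF A ev] obtain y where
    y: "\<And>i. i < n \<Longrightarrow> (\<Sum>j<n. A $$ (i, j) * y $ j) = x * y $ i" "\<exists>i<n. y $ i \<noteq> 0" by blast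
  define N where "N = Max ((\<lambda>i. \<bar>y $ i\<bar>) ` {..<n})"
  have le: "\<bar>y $ i\<bar> \<le> N" if "i < n" for i unfolding N_def using that by simp
  have "N \<in> (\<lambda>i. \<bar>y $ i\<bar>) ` {..<n}" unfolding N_def using y(2) by (intro Max_in) auto
  then obtain i where i: "i < n" "\<bar>y $ i\<bar> = N" by auto
  have N: "N > 0" using y(2) le by (force simp: not_less)
  have "x * N \<le> \<bar>x * y $ i\<bar>" using N i by (simp add: abs_mult)
  also have "\<dots> \<le> (\<Sum>j<n. \<bar>A $$ (i, j) * y $ j\<bar>)" unfolding y(1)[OF i(1), symmetric] by (rule sum_abs)
  also have "\<dots> \<le> (\<Sum>j<n. A $$ (i, j) * N)"
    using nonneg i le by (intro sum_mono) (auto simp: abs_mult intro!: mult_left_mono)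
  also have "\<dots> = k * N" using row[OF i(1)] by (simp flip: sum_distrib_right)
  finally show ?thesis using N by simp
qed

lemma const_row_sum_eigenvector:
  assumes A: "A \<in> carrier_mat n n" and row: "\<And>i. i < n \<Longrightarrow> (\<Sum>j<n. A $$ (i, j)) = (k :: real)"
  shows "A *\<^sub>v vec n (\<lambda>_. 1) = k \<cdot>\<^sub>v vec n (\<lambda>_. 1)"
  using A row mult_mat_vec_index_sum[OF A, of "vec n (\<lambda>_. 1)"] by (intro eq_vecI) auto

text \<open>For an eigenvector with coordinate sum \<open>s\<close>, every row of the equation reads
  \<open>(x + 1) * y $ i = s\<close>. Summing over the rows gives
  \<open>(x + 1) * s = n * s\<close>, so \<open>x = n - 1\<close> unless \<open>s = 0\<close>; in
  that case a nonzero coordinate forces \<open>x = - 1\<close>.\<close>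

lemma complete_eigenvalue:
  assumes A: "A \<in> carrier_mat n n"
    and ent: "\<And>i j. i < n \<Longrightarrow> j < n \<Longrightarrow> A $$ (i, j) = (if i = j then 0 else 1)"
    and ev: "eigenvalue A (x :: real)"
  shows "x = real n - 1 \<or> x = - 1"
proof -
  from eigenvectorE_sum[OF A ev] obtain y where
    y: "\<And>i. i < n \<Longrightarrow> (\<Sum>j<n. A $$ (i, j) * y $ j) = x * y $ i" "\<exists>i<n. y $ i \<noteq> 0" by blast
  define s where "s = (\<Sum>j<n. y $ j)"
  have *: "(x + 1) * y $ i = s" if "i < n" for i
  proof -
    have "x * y $ i = (\<Sum>j<n. y $ j - (if j = i then y $ j else 0))"
      unfolding y(1)[OF that, symmetric] using that by (intro sum.cong) (auto simp: ent)
    also have "\<dots> = s - y $ i" using that by (simp add: sum_subtractf s_def)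
    finally show ?thesis by (simp add: algebra_simps)
  qed
  have "(x + 1) * s = n * s"
  proof -
    have "(x + 1) * s = (\<Sum>i<n. (x + 1) * y $ i)" by (simp add: s_def sum_distrib_left)
    also have "\<dots> = n * s" using * by simp
    finally show ?thesis .
  qed
  moreover have "x = - 1" if "s = 0" using y(2) * that by fastforce
  ultimately show ?thesis by auto
qed

section \<open>Adjacency matrices of graphs\<close>

lemma adjacency_matrix_carrier [simp]:
  "adjacency_matrix G vs \<in> carrier_mat (length vs) (length vs)"
  by (simp add: adjacency_matrix_def)

lemma adjacency_matrix_index:
  "i < length vs \<Longrightarrow> j < length vs \<Longrightarrow>
    adjacency_matrix G vs $$ (i, j) = (if vs ! i \<rightarrow>\<^bsub>G\<^esub> vs ! j then 1 else 0)"
  by (simp add: adjacency_matrix_def)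

lemma (in graph) arcs_ends_commute: "u \<rightarrow>\<^bsub>G\<^esub> v \<longleftrightarrow> v \<rightarrow>\<^bsub>G\<^esub> u"
  using sym_arcs by (auto simp: symmetric_def dest: symD)

lemma (in graph) transpose_adjacency_matrix:
  "transpose_mat (adjacency_matrix G vs) = adjacency_matrix G vs"
  using arcs_ends_commute by (intro eq_matI) (auto simp: adjacency_matrix_def)

text \<open>The row counts neighbours while \<open>out_degree\<close> counts arcs. The numbers agree
  because, without parallel arcs, \<open>head G\<close> is injective on the arcs leaving a
  vertex.\<close>

lemma (in graph) adjacency_matrix_row_sum:
  assumes "distinct vs" "set vs = verts G" "i < length vs"
  shows "(\<Sum>j<length vs. adjacency_matrix G vs $$ (i, j)) = out_degree G (vs ! i)"
proof -
  let ?u = "vs ! i"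
  have "(\<Sum>j<length vs. adjacency_matrix G vs $$ (i, j))
    = (\<Sum>j<length vs. if ?u \<rightarrow>\<^bsub>G\<^esub> vs ! j then 1 else 0)"
    using assms(3) by (intro sum.cong) (auto simp: adjacency_matrix_index)
  also have "\<dots> = (\<Sum>w\<in>verts G. if ?u \<rightarrow>\<^bsub>G\<^esub> w then 1 else 0)"
    by (rule sum.reindex_bij_betw, rule bij_betw_nth) (use assms in auto)
  also have "\<dots> = card {w \<in> verts G. ?u \<rightarrow>\<^bsub>G\<^esub> w}"
    by (simp add: sum.If_cases Int_def)
  also have "{w \<in> verts G. ?u \<rightarrow>\<^bsub>G\<^esub> w} = head G ` out_arcs G ?u"
    by (auto simp: out_arcs_def arcs_ends_conv intro: rev_image_eqI)
  also have "card \<dots> = out_degree G ?u"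
    unfolding out_degree_def
    by (intro card_image inj_onI) (auto simp: out_arcs_def arc_to_ends_def intro: no_multi_arcs)
  finally show ?thesis .
qed

text \<open>Entries are 0 or 1 and symmetric, so each summand equals the entry at
  \<open>(i, l)\<close>, and the sum is a row sum.\<close>

lemma (in graph) adjacency_matrix_square_diag:
  assumes "distinct vs" "set vs = verts G" "i < length vs"
  shows "(\<Sum>l<length vs. adjacency_matrix G vs $$ (i, l) * adjacency_matrix G vs $$ (l, i))
    = out_degree G (vs ! i)"
  unfolding adjacency_matrix_row_sum[OF assms, symmetric]
  using assms(3) by (intro sum.cong) (auto simp: adjacency_matrix_index arcs_ends_commute)

section \<open>Distances in a graph\<close>

lemma (in graph) \<mu>_unit_le_2:
  assumes "u \<in> verts G" "u = v \<or> u \<rightarrow>\<^bsub>G\<^esub> v \<or> (\<exists>w. u \<rightarrow>\<^bsub>G\<^esub> w \<and> w \<rightarrow>\<^bsub>G\<^esub> v)"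
  shows "\<mu> (\<lambda>_. 1) u v \<le> 2"
proof -
  obtain p where p: "awalk u p v" "length p \<le> 2"
  proof -
    consider "u = v" | "u \<rightarrow>\<^bsub>G\<^esub> v" | w where "u \<rightarrow>\<^bsub>G\<^esub> w" "w \<rightarrow>\<^bsub>G\<^esub> v" using assms(2) by blast
    then show thesis
    proof cases
      case 1
      then show ?thesis using assms(1) by (intro that[of "[]"]) (auto simp: awalk_Nil_iff)
    next
      case 2
      then obtain e where "e \<in> arcs G" "tail G e = u" "head G e = v" by blast
      then show ?thesis using assms(1) by (intro that[of "[e]"]) (auto simp: awalk_Cons_iff awalk_Nil_iff)
    next
      case 3
      then obtain e f where "e \<in> arcs G" "tail G e = u" "head G e = w"
        "f \<in> arcs G" "tail G f = w" "head G f = v" by blast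
      then show ?thesis using assms(1) by (intro that[of "[e, f]"]) (auto simp: awalk_Cons_iff awalk_Nil_iff)
    qed
  qed
  have "\<mu> (\<lambda>_. 1) u v \<le> ereal (awalk_cost (\<lambda>_. 1) p)" using p(1) by (rule min_cost_le_walk_cost)
  also have "awalk_cost (\<lambda>_. 1) p = length p" by (simp add: awalk_cost_def sum_list_triv)
  also have "ereal (length p) \<le> 2" using p(2) by simp
  finally show ?thesis .
qed

text \<open>A walk with fewer than two arcs forces \<open>u = v\<close> or adjacency. If no walk
  exists, the infimum over the empty set is \<infinity>, so the bound covers that case too.\<close>

lemma (in graph) \<mu>_unit_ge_2:
  assumes "u \<noteq> v" "\<not> u \<rightarrow>\<^bsub>G\<^esub> v"
  shows "\<mu> (\<lambda>_. 1) u v \<ge> 2"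
  unfolding \<mu>_def
proof (rule INF_greatest)
  fix p assume "p \<in> {p. awalk u p v}"
  then have p: "awalk u p v" by simp
  have "length p \<ge> 2"
  proof (rule ccontr)
    assume "\<not> 2 \<le> length p"
    then consider "p = []" | e where "p = [e]" by (cases p; cases "tl p") auto
    then show False using p assms
      by cases (auto simp: awalk_Cons_iff awalk_Nil_iff arcs_ends_conv)
  qed
  moreover have "awalk_cost (\<lambda>_. 1) p = length p" by (simp add: awalk_cost_def sum_list_triv)
  ultimately show "2 \<le> ereal (awalk_cost (\<lambda>_. 1) p)" by simp
qed

text \<open>Serves in contrapositive form: at least three distinct eigenvalues yield two distinct
  nonadjacent vertices. The zero diagonal comes from the absence of loops.\<close>

lemma (in graph) complete_adjacency_spectrum:
  assumes "distinct vs" "set vs = verts G"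
    and "\<And>u v. u \<in> verts G \<Longrightarrow> v \<in> verts G \<Longrightarrow> u \<noteq> v \<Longrightarrow> u \<rightarrow>\<^bsub>G\<^esub> v"
  shows "spectrum (adjacency_matrix G vs) \<subseteq> {real (length vs) - 1, - 1}"
proof
  fix x assume "x \<in> spectrum (adjacency_matrix G vs)"
  then have ev: "eigenvalue (adjacency_matrix G vs) x" by (simp add: spectrum_def)
  have "adjacency_matrix G vs $$ (i, j) = (if i = j then 0 else 1)"
    if "i < length vs" "j < length vs" for i j
  proof -
    have "vs ! i \<in> verts G" "vs ! j \<in> verts G" using that assms(2) nth_mem by blast+
    moreover have "\<not> vs ! i \<rightarrow>\<^bsub>G\<^esub> vs ! i" using adj_not_same by blast
    ultimately show ?thesis
      using that assms(3) nth_eq_iff_index_eq[OF assms(1)] by (auto simp: adjacency_matrix_index)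
  qed
  from complete_eigenvalue[OF adjacency_matrix_carrier this ev]
  show "x \<in> {real (length vs) - 1, - 1}" by auto
qed

section \<open>The diameter of a regular graph from its spectrum\<close>

theorem proposition4p1:
  fixes G :: "('a, 'b) pre_digraph"
    and vs :: "'a list"
    and n d i :: nat
    and \<theta> :: "nat \<Rightarrow> real"
  assumes "graph G"
    and "regular G"
    and "n = card (verts G)"
    and "distinct vs" and "set vs = verts G"
    and "d \<ge> 2"
    and "\<forall>j k. j < k \<and> k \<le> d \<longrightarrow> \<theta> k < \<theta> j"
    and "spectrum (adjacency_matrix G vs) = \<theta> ` {0..d}"
    and "i \<le> d" and "\<theta> i \<le> -1"
    and "\<forall>j\<le>d. \<theta> j \<le> -1 \<longrightarrow> \<theta> j \<le> \<theta> i"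
    and "real n * ((\<theta> 0 + \<theta> i * \<theta> (i - 1)) / ((\<theta> 0 - \<theta> i) * (\<theta> 0 - \<theta> (i - 1)))) < 2"
  shows "graph_diameter G = 2"
proof -
  interpret graph G by fact
  note vs = assms(4,5)
  have n: "length vs = n" using assms(3) vs by (metis distinct_card)
  obtain k where k: "\<And>v. v \<in> verts G \<Longrightarrow> out_degree G v = k"
    using assms(2) by (auto simp: regular_def)
  have nth: "vs ! l \<in> verts G" if "l < n" for l using that n vs(2) nth_mem by metis
  define A where "A = adjacency_matrix G vs"
  have A: "A \<in> carrier_mat n n" "transpose_mat A = A"
    using transpose_adjacency_matrix n by (auto simp: A_def)
  have entry: "A $$ (l, m) = (if vs ! l \<rightarrow>\<^bsub>G\<^esub> vs ! m then 1 else 0)" if "l < n" "m < n" for l m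
    using that n by (simp add: A_def adjacency_matrix_index)
  have row: "(\<Sum>j<n. A $$ (l, j)) = k" if "l < n" for l
    using adjacency_matrix_row_sum[OF vs, of l] that n k nth by (simp add: A_def)
  have spec: "eigenvalue A x \<longleftrightarrow> (\<exists>j\<le>d. x = \<theta> j)" for x
    using assms(8) by (auto simp: spectrum_def A_def set_eq_iff image_iff)
  have decr: "\<theta> m < \<theta> l" if "l < m" "m \<le> d" for l m using assms(7) that by blast
  have decr_le: "\<theta> m \<le> \<theta> l" if "l \<le> m" "m \<le> d" for l m
    using decr[of l m] that by (cases "l = m") auto

  define e where "e = vec n (\<lambda>_. 1 :: real)"
  have e: "e \<in> carrier_vec n" by (simp add: e_def)
  have Ae: "A *\<^sub>v e = real k \<cdot>\<^sub>v e"
    unfolding e_def by (rule const_row_sum_eigenvector[OF A(1) row])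
  \<comment> \<open>The spectrum contains \<open>\<theta> 0\<close>, and a matrix of size 0 has no
    eigenvector.\<close>
  have "n > 0"
  proof (rule ccontr)
    assume "\<not> n > 0"
    have "eigenvalue A (\<theta> 0)" using spec by blast
    then show False by (rule eigenvectorE_sum[OF A(1)]) (use \<open>\<not> n > 0\<close> in simp)
  qed
  \<comment> \<open>The row sums bound every eigenvalue by \<open>k\<close>, and the all-one vector
    attains \<open>k\<close>.\<close>
  have \<theta>0: "\<theta> 0 = k"
  proof (rule antisym)
    have "eigenvalue A (\<theta> 0)" using spec by blast
    then show "\<theta> 0 \<le> k"
      by (rule eigenvalue_le_row_sum[OF A(1) _ row, rotated -1]) (simp_all add: entry)
    have "e \<noteq> 0\<^sub>v n"
    proof
      assume "e = 0\<^sub>v n"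
      then have "e $ 0 = 0" using \<open>n > 0\<close> by simp
      then show False using \<open>n > 0\<close> by (simp add: e_def)
    qed
    then have "eigenvalue A k" using A e Ae by (auto simp: eigenvalue_def eigenvector_def)
    then obtain j where "j \<le> d" "k = \<theta> j" using spec by blast
    then show "k \<le> \<theta> 0" using decr_le[of 0 j] by simp
  qed
  \<comment> \<open>Otherwise \<open>k \<le> -1\<close>. On the naturals \<open>0 - 1 = 0\<close>,
    so only now is \<open>\<theta> (i - 1)\<close> known to be the eigenvalue preceding
    \<open>\<theta> i\<close>.\<close>
  have "i \<noteq> 0" using \<theta>0 assms(10) by (intro notI) simp

  define B where "B = quadratic_mat (\<theta> i) (\<theta> (i - 1)) A"
  have B: "B \<in> carrier_mat n n" "transpose_mat B = B"
    using A transpose_quadratic_mat[OF A] by (auto simp: B_def)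
  have psd: "psd B"
    unfolding B_def
  proof (rule psd_quadratic_mat[OF A])
    fix x assume "eigenvalue A x"
    then obtain j where j: "j \<le> d" "x = \<theta> j" using spec by blast
    \<comment> \<open>The two roots are consecutive eigenvalues, so no eigenvalue lies strictly
      between them and both factors have the same sign or one of them vanishes.\<close>
    show "(x - \<theta> i) * (x - \<theta> (i - 1)) \<ge> 0"
    proof (cases "j < i")
      case True
      then have "\<theta> i \<le> x" "\<theta> (i - 1) \<le> x" using j assms(9) by (auto intro: decr_le)
      then show ?thesis by simp
    next
      case False
      then have "x \<le> \<theta> i" "x \<le> \<theta> (i - 1)" using j assms(9) by (auto intro: decr_le)
      then show ?thesis by (simp add: mult_nonpos_nonpos)
    qed
  qed
  have diag: "B $$ (l, l) = k + \<theta> i * \<theta> (i - 1)" if "l < n" for l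
  proof -
    have "A $$ (l, l) = 0" using that adj_not_same by (auto simp: entry)
    moreover have "(\<Sum>m<n. A $$ (l, m) * A $$ (m, l)) = k"
      using adjacency_matrix_square_diag[OF vs, of l] that n k nth by (simp add: A_def)
    ultimately show ?thesis using that by (simp add: B_def quadratic_mat_index[OF A(1)])
  qed

  have "i \<noteq> 1"
  proof
    assume i: "i = 1"
    have "B = 0\<^sub>m n n"
    proof (rule psd_diag_nonpos_imp_zero[OF B psd])
      fix l assume "l < n"
      have "real k * (1 + \<theta> 1) \<le> 0" using assms(10) i by (intro mult_nonneg_nonpos) auto
      then show "B $$ (l, l) \<le> 0" using diag[OF \<open>l < n\<close>] i \<theta>0 by (simp add: algebra_simps)
    qed
    \<comment> \<open>An eigenvector for \<open>\<theta> 2\<close> is one of \<open>B\<close> too,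
      with eigenvalue \<open>(\<theta> 2 - \<theta> 1) * (\<theta> 2 - \<theta> 0)\<close>. This is
      nonzero, against \<open>B = 0\<close>.\<close>
    moreover have "eigenvalue A (\<theta> 2)" using spec assms(6) by blast
    then obtain y where y: "y \<in> carrier_vec n" "y \<noteq> 0\<^sub>v n" "A *\<^sub>v y = \<theta> 2 \<cdot>\<^sub>v y"
      using A by (auto simp: eigenvalue_def eigenvector_def)
    moreover have "0\<^sub>m n n *\<^sub>v y = 0\<^sub>v n" using y(1) by (intro eq_vecI) auto
    ultimately have "((\<theta> 2 - \<theta> 1) * (\<theta> 2 - \<theta> 0)) \<cdot>\<^sub>v y = 0\<^sub>v n"
      using quadratic_mat_eigenvector[OF A(1) y(1,3), of "\<theta> i" "\<theta> (i - 1)"] i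
      by (simp add: B_def)
    moreover have "(\<theta> 2 - \<theta> 1) * (\<theta> 2 - \<theta> 0) \<noteq> 0"
      using decr[of 1 2] decr[of 0 2] assms(6) by simp
    ultimately show False using y(1,2) by (auto simp: vec_eq_iff)
  qed
  with \<open>i \<noteq> 0\<close> have "\<theta> i < \<theta> 0" "\<theta> (i - 1) < \<theta> 0" using assms(9) by (auto intro!: decr)
  \<comment> \<open>Now \<open>i \<ge> 2\<close>, so the denominator in the hypothesis is a product
    of two positive factors.\<close>
  then have pos: "(\<theta> 0 - \<theta> i) * (\<theta> 0 - \<theta> (i - 1)) > 0" by simp

  have close: "u = v \<or> u \<rightarrow>\<^bsub>G\<^esub> v \<or> (\<exists>w. u \<rightarrow>\<^bsub>G\<^esub> w \<and> w \<rightarrow>\<^bsub>G\<^esub> v)"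
    if uv: "u \<in> verts G" "v \<in> verts G" for u v
  proof (rule ccontr)
    assume far: "\<not> ?thesis"
    obtain a b where ab: "a < n" "b < n" "u = vs ! a" "v = vs ! b"
      using uv vs n by (metis in_set_conv_nth)
    have "(\<Sum>l<n. A $$ (a, l) * A $$ (l, b)) = 0"
      using far ab by (intro sum.neutral) (auto simp: entry)
    \<comment> \<open>All three terms of the quadratic polynomial vanish at \<open>(a, b)\<close>:
      there is no common neighbour, no adjacency, and \<open>a \<noteq> b\<close>.\<close>
    then have "B $$ (a, b) = 0"
      using far ab by (auto simp: B_def quadratic_mat_index[OF A(1)] entry)
    moreover have "B *\<^sub>v e = ((\<theta> 0 - \<theta> i) * (\<theta> 0 - \<theta> (i - 1))) \<cdot>\<^sub>v e"
      unfolding B_def by (rule quadratic_mat_eigenvector[OF A(1) e]) (simp add: Ae \<theta>0)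
    ultimately have "2 * ((\<theta> 0 - \<theta> i) * (\<theta> 0 - \<theta> (i - 1))) \<le> n * (\<theta> 0 + \<theta> i * \<theta> (i - 1))"
      unfolding e_def using ab diag \<theta>0 by (intro psd_two_unit_vecs[OF B psd _ ab(1,2)]) auto
    then have "2 \<le> real n * (\<theta> 0 + \<theta> i * \<theta> (i - 1)) / ((\<theta> 0 - \<theta> i) * (\<theta> 0 - \<theta> (i - 1)))"
      using pos by (simp only: pos_le_divide_eq)
    with assms(12) show False by simp
  qed
  obtain u v where uv: "u \<in> verts G" "v \<in> verts G" "u \<noteq> v" "\<not> u \<rightarrow>\<^bsub>G\<^esub> v"
  proof -
    \<comment> \<open>Already \<open>\<theta> 0\<close>, \<open>\<theta> 1\<close> and
      \<open>\<theta> 2\<close> are too many for a set of two elements.\<close>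
    have "\<not> \<theta> ` {0..d} \<subseteq> {real (length vs) - 1, - 1}"
    proof
      assume "\<theta> ` {0..d} \<subseteq> {real (length vs) - 1, - 1}"
      then have "\<theta> l \<in> {real (length vs) - 1, - 1}" if "l \<le> d" for l
        using that by (auto simp: image_subset_iff)
      from this[of 0] this[of 1] this[of 2]
      show False using decr[of 0 1] decr[of 1 2] assms(6) by auto
    qed
    then show thesis using complete_adjacency_spectrum[OF vs] assms(8) that by metis
  qed
  show ?thesis
  proof (rule antisym)
    show "graph_diameter G \<le> 2"
      unfolding graph_diameter_def using close by (intro SUP_least \<mu>_unit_le_2) auto
    have "2 \<le> \<mu> (\<lambda>_. 1) u v" using uv by (intro \<mu>_unit_ge_2)
    also have "\<dots> \<le> graph_diameter G"
      unfolding graph_diameter_def using uv by (auto intro: SUP_upper2)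
    finally show "2 \<le> graph_diameter G" .
  qed
qed

end
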